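(* Let $0<\sigma<1$, and let $f$ be a meromorphic function in $\mathbf{C}$ of infinite order whose Nevanlinna characteristic satisfies $T(r,f)>0$ for all $r>0$. Write $T^\sigma(r,f)=(T(r,f))^\sigma$ and put $R=r+\frac{1}{\exp(T^\sigma(r,f))}$. Then $$\log^+\Bigl(\frac{T(R,f)}{R-r}\,\frac{R}{r}\Bigr)\le\Bigl(\frac{\sigma+1}{\sigma}\Bigr)T^\sigma(r,f)+\log\Bigl(1+\frac{1}{r\exp(T^\sigma(r,f))}\Bigr)$$ for all $r\in(0,\infty)$ outside a possible exceptional set of finite linear measure at most $S_e$, where the constant $S_e=\sum_{n=0}^\infty a_n^{-1}$ is independent of $\sigma$.
   Context: Linear measure means Lebesgue measure on the real line. The sequence $(a_n)$ is defined by $a_0=1$, $a_1=e$, and $a_n=e^{a_{n-1}}$ recursively for $n\ge1$. $\log^+x=\max\{\log x,0\}$ for $x>0$, and $\log^+0=0$. For a meromorphic function $f$ in $\mathbf{C}$, let $n(t,f;\infty)$ be the number of poles of $f$, counted with multiplicity, in $|z|\le t$, and set $$m(r,f;\infty)=\frac{1}{2\pi}\int_0^{2\pi}\log^+|f(re^{i\theta})|\,d\theta,$$ $$N(r,f;\infty)=\int_0^r\frac{n(t,f;\infty)-n(0,f;\infty)}{t}\,dt+n(0,f;\infty)\log r.$$ The Nevanlinna characteristic is $T(r,f)=m(r,f;\infty)+N(r,f;\infty)$; it is a continuous increasing function of $r$. The order of $f$ is $\rho(f)=\limsup_{r\to\infty}\frac{\log T(r,f)}{\log r}$, and $f$ has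 infinite order if $\rho(f)=\infty$. *)

theory Defs
  imports "HOL-Complex_Analysis.Complex_Analysis"
begin

definition log_plus :: "real \<Rightarrow> real" where
  "log_plus x = (if x > 0 then max (ln x) 0 else 0)"

text \<open>At a pole, \<^const>\<open>zorder\<close> is minus the multiplicity of the pole.\<close>

definition pole_count :: "(complex \<Rightarrow> complex) \<Rightarrow> real \<Rightarrow> nat" where
  "pole_count f t = (\<Sum>z | cmod z \<le> t \<and> is_pole f z. nat (- zorder f z))"

text \<open>A function that is \<open>meromorphic_on UNIV\<close> may take arbitrary values at its poles and
  removable singularities. This does not affect the integral below, because a circle contains
  only finitely many such points.\<close>

definition nev_proximity :: "(complex \<Rightarrow> complex) \<Rightarrow> real \<Rightarrow> real" where
  "nev_proximity f r =
     1 / (2 * pi) * integral {0..2*pi} (\<lambda>\<theta>. log_plus (cmod (f (of_real r * cis \<theta>))))"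

definition nev_counting :: "(complex \<Rightarrow> complex) \<Rightarrow> real \<Rightarrow> real" where
  "nev_counting f r =
     integral {0..r} (\<lambda>t. (real (pole_count f t) - real (pole_count f 0)) / t)
       + real (pole_count f 0) * ln r"

definition nev_char :: "(complex \<Rightarrow> complex) \<Rightarrow> real \<Rightarrow> real" where
  "nev_char f r = nev_proximity f r + nev_counting f r"

definition nev_order :: "(complex \<Rightarrow> complex) \<Rightarrow> ereal" where
  "nev_order f = Limsup at_top (\<lambda>r. ereal (ln (nev_char f r) / ln r))"

primrec exp_tower :: "nat \<Rightarrow> real" where
  "exp_tower 0 = 1"
| "exp_tower (Suc n) = exp (exp_tower n)"

definition S_e :: real where
  "S_e = (\<Sum>n. inverse (exp_tower n))"

text \<open>The series defining \<^const>\<open>S_e\<close> converges, so its value is meaningful.\<close>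

lemma exp_tower_ge: "2 ^ n \<le> exp_tower n"
proof (induction n)
  case 0
  show ?case by simp
next
  case (Suc n)
  define x where "x = exp_tower n"
  have x: "2 ^ n \<le> x"
    using Suc unfolding x_def .
  have "0 \<le> x"
    by (rule order_trans[OF _ x]) simp
  have "2 * x \<le> (1 + x / 2)\<^sup>2"
    using zero_le_power2[of "1 - x / 2"] by (simp add: power2_eq_square algebra_simps)
  also have "\<dots> \<le> (exp (x / 2))\<^sup>2"
    by (rule power_mono) (use \<open>0 \<le> x\<close> exp_ge_add_one_self[of "x / 2"] in linarith)+
  also have "\<dots> = exp x"
    using exp_double[of "x / 2"] by simp
  finally have "2 * x \<le> exp x" .
  with x have "2 * 2 ^ n \<le> exp x"
    by linarith
  then show ?case
    by (simp add: x_def)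
qed

lemma summable_inverse_exp_tower: "summable (\<lambda>n. inverse (exp_tower n))"
proof (rule summable_comparison_test')
  show "summable (\<lambda>n. (1 / 2 :: real) ^ n)"
    by (rule summable_geometric) simp
  fix n :: nat
  have "0 < (2::real) ^ n"
    by simp
  then have "inverse (exp_tower n) \<le> inverse (2 ^ n)"
    using exp_tower_ge[of n] by (rule le_imp_inverse_le[rotated])
  moreover have "0 \<le> inverse (exp_tower n)"
    using order_less_le_trans[OF \<open>0 < (2::real) ^ n\<close> exp_tower_ge[of n]] by simp
  ultimately show "norm (inverse (exp_tower n)) \<le> (1 / 2) ^ n"
    by (simp only: real_norm_def abs_of_nonneg power_one_over inverse_eq_divide)
qed

end

theory Submission
  imports Defs
begin

text \<open>With \<open>u = T\<^sup>\<sigma>\<close> and \<open>R = r + exp (- u r)\<close> the claim reduces to \<open>u R \<le> exp (u r)\<close>. This is a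
  growth lemma of Borel type about nonnegative nondecreasing functions (\<open>Borel_growth_exp\<close>). The
  values of \<open>r\<close> where it fails and \<open>u r\<close> lies between two consecutive terms of the exponential tower
  fit into an interval whose length is the reciprocal of the upper term, because one step from \<open>r\<close>
  to \<open>R\<close> already lifts \<open>u\<close> above that term. Summation over the terms gives \<open>S\<^sub>e\<close>.

  The rest of the work is to show that the characteristic is nondecreasing (\<open>nev_char_mono\<close>). On a
  disc that contains the circles under consideration write \<open>f = g / h\<close>, where the polynomial \<open>h\<close>
  vanishes exactly at the poles and \<open>g\<close> has no zero in common with \<open>h\<close>
  (\<open>meromorphic_compact_quotient\<close>). Jensen's formula for the linear factors of \<open>h\<close>
  (\<open>has_integral_ln_dist_circle\<close>) shows that the counting function of the poles is, up to a constant,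
  the mean of \<open>ln \<bar>h\<bar>\<close> over the circle. Therefore \<open>T(r, f)\<close> is, up to a constant, the mean
  over the circle of radius \<open>r\<close> of the continuous subharmonic function \<open>ln (max \<bar>g\<bar> \<bar>h\<bar>)\<close>.

  Such means do not decrease as the radius grows (\<open>circle_mean_ln_max_mono\<close>). Instead of a Poisson integral, the
  proof uses the Stone-Weierstrass theorem to approximate the boundary values by the real part of a
  polynomial, and then compares inside the disc with the maximum modulus principle.\<close>

section \<open>Means of holomorphic functions over circles\<close>

lemma has_integral_circle_mean_holomorphic:
  fixes F :: "complex \<Rightarrow> complex"
  assumes "continuous_on (cball 0 r) F" "F holomorphic_on ball 0 r" "0 < r"
  shows "((\<lambda>\<theta>. F (of_real r * cis \<theta>)) has_integral 2 * pi * F 0) {0..2*pi}"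
proof -
  have "((\<lambda>u. F u / (u - 0)) has_contour_integral 2 * of_real pi * \<i> * F 0) (circlepath 0 r)"
    by (rule Cauchy_integral_circlepath) (use assms in auto)
  then have "((\<lambda>t. F (of_real r * cis t) / (of_real r * cis t) * r * \<i> * cis t)
      has_integral 2 * of_real pi * \<i> * F 0) {0..2*pi}"
    unfolding circlepath_def by (subst (asm) has_contour_integral_part_circlepath_iff) auto
  also have "(\<lambda>t. F (of_real r * cis t) / (of_real r * cis t) * r * \<i> * cis t) =
     (\<lambda>t. F (of_real r * cis t) * \<i>)"
    using assms by (auto simp: fun_eq_iff)
  finally have "((\<lambda>t. F (of_real r * cis t) * \<i> * (-\<i>)) has_integral
      2 * of_real pi * \<i> * F 0 * (-\<i>)) {0..2*pi}"
    by (rule has_integral_mult_left)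
  moreover have "z * \<i> * (-\<i>) = z" "2 * of_real pi * \<i> * z * (-\<i>) = of_real (2 * pi) * z" for z :: complex
    by (simp_all add: mult_ac)
  ultimately show ?thesis
    by (simp only:)
qed

lemma has_integral_circle_mean_Re:
  assumes "continuous_on (cball 0 r) F" "F holomorphic_on ball 0 r" "0 < r"
  shows "((\<lambda>\<theta>. Re (F (of_real r * cis \<theta>))) has_integral 2 * pi * Re (F 0)) {0..2*pi}"
  using has_integral_linear[OF has_integral_circle_mean_holomorphic[OF assms] bounded_linear_Re]
  by (simp add: o_def)

section \<open>The mean of the logarithmic distance to a point\<close>

lemma has_integral_ln_one_minus_inside:
  assumes "cmod b < 1"
  shows "((\<lambda>\<theta>. ln (cmod (1 - b * cis \<theta>))) has_integral 0) {0..2*pi}"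
proof -
  have nz: "1 - b * z \<notin> \<real>\<^sub>\<le>\<^sub>0" if "cmod z \<le> 1" for z
  proof -
    have "cmod (b * z) < 1"
      using that assms mult_right_le_one_le[of "cmod b" "cmod z"] by (simp add: norm_mult)
    then have "Re (b * z) < 1"
      using complex_Re_le_cmod[of "b * z"] by linarith
    then show ?thesis
      by (auto simp: complex_nonpos_Reals_iff)
  qed
  let ?F = "\<lambda>z. Ln (1 - b * z)"
  have hol: "?F holomorphic_on ball 0 1"
    by (intro holomorphic_intros) (use nz in auto)
  have cont: "continuous_on (cball 0 1) ?F"
    by (intro continuous_intros) (use nz in auto)
  have "((\<lambda>\<theta>. Re (?F (of_real 1 * cis \<theta>))) has_integral 2 * pi * Re (?F 0)) {0..2*pi}"
    by (rule has_integral_circle_mean_Re[OF cont hol]) simp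
  moreover have "Re (?F (of_real 1 * cis \<theta>)) = ln (cmod (1 - b * cis \<theta>))" for \<theta>
  proof -
    have "1 - b * cis \<theta> \<noteq> 0" using nz[of "cis \<theta>"] by auto
    then show ?thesis by simp
  qed
  ultimately show ?thesis by simp
qed

lemma finite_cis_eq: "finite {\<theta> \<in> {0..2*pi}. cis \<theta> = w}"
proof -
  have "finite {\<theta> \<in> {0..<2*pi}. cis \<theta> = w}"
  proof (cases "\<exists>\<theta>0\<in>{0..<2*pi}. cis \<theta>0 = w")
    case True
    then obtain t where t: "t \<in> {0..<2*pi}" "cis t = w" by auto
    have "{\<theta> \<in> {0..<2*pi}. cis \<theta> = w} \<subseteq> {t}"
    proof safe
      fix x :: real assume x: "x \<in> {0..<2*pi}" "w = cis x"
      then have "cis x = cis t" using t by simp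
      then have "sin x = sin t \<and> cos x = cos t"
        by (simp add: complex_eq_iff)
      then obtain n::int where n: "x = t + 2 * pi * n"
        using sin_cos_eq_iff[of x t] by auto
      have "0 \<le> x" "x < 2 * pi" "0 \<le> t" "t < 2 * pi" using x t by auto
      then have "2 * pi * n < 2 * pi * 1" "2 * pi * (- 1) < 2 * pi * n" using n by linarith+
      then have "real_of_int n < 1" "- 1 < real_of_int n"
        by (simp_all only: mult_less_cancel_left_pos[of "2 * pi"] pi_gt_zero mult_pos_pos
            zero_less_numeral)
      then have "n = 0" by linarith
      then show "x = t" using n by simp
    qed
    then show ?thesis by (rule finite_subset) simp
  next
    case False
    then have "{\<theta> \<in> {0..<2*pi}. cis \<theta> = w} = {}" by auto
    then show ?thesis by (simp only: finite.emptyI)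
  qed
  moreover have "{\<theta> \<in> {0..2*pi}. cis \<theta> = w} \<subseteq> insert (2*pi) {\<theta> \<in> {0..<2*pi}. cis \<theta> = w}"
    by auto
  ultimately show ?thesis
    by (meson finite.insertI finite_subset)
qed

lemma finite_circle_vimage:
  assumes "finite B" "r > 0"
  shows "finite {\<theta> \<in> {0..2*pi}. of_real r * cis \<theta> \<in> B}"
proof -
  have "{\<theta> \<in> {0..2*pi}. of_real r * cis \<theta> \<in> B}
      = (\<Union>b\<in>B. {\<theta> \<in> {0..2*pi}. cis \<theta> = b / of_real r})"
    using assms by (auto simp: field_simps)
  then show ?thesis using assms finite_cis_eq by simp
qed

text \<open>For \<open>\<bar>w\<bar> = 1\<close> the numerator alone is not monotone in the radius, but the square of the quotient is
  \<open>1 - 2 (1 + Re w) x / (1 + x)\<^sup>2\<close>, and \<open>x / (1 + x)\<^sup>2\<close> increases on \<open>[0, 1]\<close>. Dividing by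
  \<open>1 + x\<close> is what makes monotone convergence applicable as the radius tends to \<open>1\<close>.\<close>

lemma cmod_one_minus_ratio_antimono:
  assumes w: "cmod w = 1" and st: "0 \<le> s" "s \<le> t" "t \<le> 1"
  shows "cmod (1 - of_real t * w) / (1 + t) \<le> cmod (1 - of_real s * w) / (1 + s)"
proof -
  have eq: "(cmod (1 - of_real x * w) / (1 + x))\<^sup>2 = 1 - (x / (1 + x)\<^sup>2) * (2 * (1 + Re w))"
    if "0 \<le> x" for x
  proof -
    have w2: "(Re w)\<^sup>2 + (Im w)\<^sup>2 = 1" using w by (metis cmod_power2 one_power2)
    have "(cmod (1 - of_real x * w))\<^sup>2 = 1 - 2 * x * Re w + x\<^sup>2 * ((Re w)\<^sup>2 + (Im w)\<^sup>2)"
      by (simp only: cmod_power2) (simp add: power2_eq_square algebra_simps)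
    also have "\<dots> = (1 + x)\<^sup>2 - x * (2 * (1 + Re w))"
      unfolding w2 by (simp add: power2_eq_square algebra_simps)
    finally show ?thesis using that by (simp add: power_divide diff_divide_distrib)
  qed
  have "s * t \<le> 1" using st mult_le_one[of s t] by auto
  then have "0 \<le> (t - s) * (1 - s * t)" using st by auto
  then have "s * (1 + t)\<^sup>2 \<le> t * (1 + s)\<^sup>2"
    by (simp add: power2_eq_square algebra_simps)
  then have "s / (1 + s)\<^sup>2 \<le> t / (1 + t)\<^sup>2"
    using st by (simp add: divide_simps)
  moreover have "0 \<le> 2 * (1 + Re w)"
    using abs_Re_le_cmod[of w] w by auto
  ultimately have "(cmod (1 - of_real t * w) / (1 + t))\<^sup>2 \<le> (cmod (1 - of_real s * w) / (1 + s))\<^sup>2"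
    unfolding eq[OF st(1)] eq[OF order_trans[OF st(1,2)]]
    by (intro diff_left_mono mult_right_mono)
  then show ?thesis
    by (rule power2_le_imp_le) (use st in auto)
qed

text \<open>Here the integrand has a logarithmic singularity on the circle, so the mean value property does not
  apply directly. Replace \<open>b\<close> by \<open>\<rho> b\<close> with \<open>\<rho>\<close> increasing to \<open>1\<close>. After
  subtracting \<open>ln (1 + \<rho>)\<close> the integrands decrease, and monotone convergence yields both
  integrability and the value of the limit.\<close>

lemma has_integral_ln_one_minus_boundary:
  assumes b: "cmod b = 1"
  shows "((\<lambda>\<theta>. ln (cmod (1 - b * cis \<theta>))) has_integral 0) {0..2*pi}"
proof -
  define \<rho> where "\<rho> k = real k / (1 + real k)" for k :: nat
  have \<rho>: "0 \<le> \<rho> k" "\<rho> k < 1" "\<rho> k \<le> \<rho> (Suc k)" for k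
    unfolding \<rho>_def by (auto simp: divide_simps algebra_simps)
  have lim\<rho>: "\<rho> \<longlonglongrightarrow> 1"
    using LIMSEQ_n_over_Suc_n[where 'a = real] unfolding \<rho>_def by (simp add: add.commute)
  define N where "N = {\<theta> \<in> {0..2*pi}. cis \<theta> = inverse b}"
  define S where "S = {0..2*pi} - N"
  have "finite N" unfolding N_def by (rule finite_cis_eq)
  then have negl: "negligible N" by (rule negligible_finite)
  have b0: "b \<noteq> 0" using b by auto
  have conv: "(f has_integral I) S \<longleftrightarrow> (f has_integral I) {0..2*pi}" for f :: "real \<Rightarrow> real" and I
    by (rule has_integral_spike_set_eq)
      (auto intro!: negligible_subset[OF negl] simp: S_def)
  define f where "f k \<theta> = ln (cmod (1 - of_real (\<rho> k) * (b * cis \<theta>)) / (1 + \<rho> k))" for k \<theta>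
  define g where "g \<theta> = ln (cmod (1 - b * cis \<theta>) / 2)" for \<theta>
  have pos: "0 < cmod (1 - of_real (\<rho> k) * (b * cis \<theta>))" for k \<theta>
  proof -
    have "cmod (of_real (\<rho> k) * (b * cis \<theta>)) < 1" using \<rho>[of k] b by (simp add: norm_mult)
    then have "1 \<noteq> of_real (\<rho> k) * (b * cis \<theta>)" by (metis less_irrefl norm_one)
    then show ?thesis by simp
  qed
  have feq: "f k = (\<lambda>\<theta>. ln (cmod (1 - (of_real (\<rho> k) * b) * cis \<theta>)) - ln (1 + \<rho> k))" for k
    using pos \<rho>[of k] by (auto simp: f_def fun_eq_iff ln_div mult.assoc)
  have intf: "(f k has_integral - (2 * pi * ln (1 + \<rho> k))) {0..2*pi}" for k
  proof -
    have "((\<lambda>\<theta>. ln (cmod (1 - (of_real (\<rho> k) * b) * cis \<theta>))) has_integral 0) {0..2*pi}"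
      by (rule has_integral_ln_one_minus_inside) (use \<rho>[of k] b in \<open>simp add: norm_mult\<close>)
    from has_integral_diff[OF this has_integral_const_real[of "ln (1 + \<rho> k)" 0 "2*pi"]]
    show ?thesis unfolding feq by simp
  qed
  have intfS: "integral S (f k) = - (2 * pi * ln (1 + \<rho> k))" "f k integrable_on S" for k
    using intf[of k] unfolding conv[symmetric] by (auto intro: integral_unique)
  have lim: "(\<lambda>k. integral S (f k)) \<longlonglongrightarrow> - (2 * pi * ln (1 + 1))"
    unfolding intfS by (intro tendsto_intros lim\<rho>) auto
  have "g integrable_on S \<and> (\<lambda>k. integral S (f k)) \<longlonglongrightarrow> integral S g"
  proof (rule monotone_convergence_decreasing)
    show "f k integrable_on S" for k by (rule intfS)
    show "f (Suc k) \<theta> \<le> f k \<theta>" for k \<theta>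
      unfolding f_def
    proof (rule ln_mono)
      show "cmod (1 - of_real (\<rho> (Suc k)) * (b * cis \<theta>)) / (1 + \<rho> (Suc k))
          \<le> cmod (1 - of_real (\<rho> k) * (b * cis \<theta>)) / (1 + \<rho> k)"
        by (rule cmod_one_minus_ratio_antimono) (use b \<rho>[of k] \<rho>(2)[of "Suc k"] in \<open>auto simp: norm_mult less_imp_le\<close>)
      show "0 < cmod (1 - of_real (\<rho> (Suc k)) * (b * cis \<theta>)) / (1 + \<rho> (Suc k))"
        using pos[of "Suc k" \<theta>] \<rho>(1)[of "Suc k"] by auto
    qed
    show "(\<lambda>k. f k \<theta>) \<longlonglongrightarrow> g \<theta>" if "\<theta> \<in> S" for \<theta>
    proof -
      have "b * cis \<theta> \<noteq> 1"
        using that b0 unfolding S_def N_def by (auto simp: field_simps)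
      then have "(\<lambda>k. f k \<theta>) \<longlonglongrightarrow> ln (cmod (1 - of_real 1 * (b * cis \<theta>)) / (1 + 1))"
        unfolding f_def by (intro tendsto_intros lim\<rho>) auto
      then show ?thesis by (simp add: g_def)
    qed
    show "bounded (range (\<lambda>k. integral S (f k)))"
      using lim convergent_def convergent_imp_bounded by blast
  qed
  then have "g integrable_on S" "integral S g = - (2 * pi * ln 2)"
    using LIMSEQ_unique[OF lim] by auto
  then have "(g has_integral - (2 * pi * ln 2)) S"
    using integrable_integral by metis
  from has_integral_add[OF this[unfolded conv] has_integral_const_real[of "ln 2" 0 "2*pi"]]
  have "((\<lambda>\<theta>. g \<theta> + ln 2) has_integral 0) {0..2*pi}" by simp
  then have "((\<lambda>\<theta>. g \<theta> + ln 2) has_integral 0) S" unfolding conv .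
  then have "((\<lambda>\<theta>. ln (cmod (1 - b * cis \<theta>))) has_integral 0) S"
  proof (rule has_integral_eq[rotated])
    fix \<theta> assume "\<theta> \<in> S"
    then have "b * cis \<theta> \<noteq> 1"
        using b0 unfolding S_def N_def by (auto simp: field_simps)
    then show "g \<theta> + ln 2 = ln (cmod (1 - b * cis \<theta>))"
      by (simp add: g_def ln_div)
  qed
  then show ?thesis unfolding conv .
qed

text \<open>This is Jensen's formula for the linear function \<open>z - a\<close>. Factoring out the larger of \<open>r\<close> and
  \<open>\<bar>a\<bar>\<close> leaves \<open>\<bar>1 - b e\<^sup>i\<^sup>\<theta>\<bar>\<close> with \<open>\<bar>b\<bar> \<le> 1\<close>, after reflecting the point in the circle
  if it lies inside. The case \<open>\<bar>a\<bar> = r\<close> is included, so circles through poles need no separate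
  treatment later.\<close>

lemma has_integral_ln_dist_circle:
  assumes r: "0 < r"
  shows "((\<lambda>\<theta>. ln (cmod (of_real r * cis \<theta> - a))) has_integral 2 * pi * ln (max r (cmod a))) {0..2*pi}"
proof -
  define M where "M = max r (cmod a)"
  define b where "b = (if cmod a \<le> r then cnj a / of_real r else of_real r / a)"
  have M: "M > 0" using r by (auto simp: M_def)
  have b1: "cmod b \<le> 1" using r by (auto simp: b_def norm_divide divide_simps)
  have eq: "cmod (of_real r * cis \<theta> - a) = M * cmod (1 - b * cis \<theta>)" for \<theta>
  proof (cases "cmod a \<le> r")
    case True
    have "of_real r * cis \<theta> - a = cis \<theta> * (of_real r * cnj (1 - b * cis \<theta>))"
      using True r by (simp add: b_def algebra_simps cis_cnj cis_mult)
    then have "cmod (of_real r * cis \<theta> - a) = cmod (cis \<theta>) * (r * cmod (1 - b * cis \<theta>))"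
      using r by (simp only: norm_mult complex_mod_cnj) simp
    then show ?thesis using True by (simp add: M_def)
  next
    case False
    then have "of_real r * cis \<theta> - a = - a * (1 - b * cis \<theta>)"
      using r by (auto simp add: b_def algebra_simps)
    then have "cmod (of_real r * cis \<theta> - a) = cmod a * cmod (1 - b * cis \<theta>)"
      by (simp only: norm_mult norm_minus_cancel)
    then show ?thesis using False by (simp add: M_def)
  qed
  have "((\<lambda>\<theta>. ln (cmod (1 - b * cis \<theta>))) has_integral 0) {0..2*pi}"
    using b1 has_integral_ln_one_minus_inside[of b] has_integral_ln_one_minus_boundary[of b]
    by (cases "cmod b = 1") (simp_all add: less_le)
  from has_integral_add[OF has_integral_const_real[of "ln M" 0 "2*pi"] this]
  have "((\<lambda>\<theta>. ln M + ln (cmod (1 - b * cis \<theta>))) has_integral 2 * pi * ln M) {0..2*pi}"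
    by simp
  moreover have "negligible {\<theta> \<in> {0..2*pi}. of_real r * cis \<theta> \<in> {a}}"
    by (intro negligible_finite finite_circle_vimage) (use r in auto)
  ultimately show ?thesis
    unfolding M_def[symmetric]
  proof (rule has_integral_spike[rotated 2])
    fix \<theta> assume "\<theta> \<in> {0..2*pi} - {\<theta> \<in> {0..2*pi}. of_real r * cis \<theta> \<in> {a}}"
    then have "0 < cmod (of_real r * cis \<theta> - a)" by auto
    then have "0 < cmod (1 - b * cis \<theta>)" using M unfolding eq by (simp add: zero_less_mult_iff)
    then show "ln (cmod (of_real r * cis \<theta> - a)) = ln M + ln (cmod (1 - b * cis \<theta>))"
      unfolding eq using M by (simp add: ln_mult)
  qed
qed

section \<open>Approximation by real parts of polynomials on a circle\<close>

text \<open>On \<open>\<bar>z\<bar> = s\<close> conjugation is the rational map \<open>z \<mapsto> s\<^sup>2 / z\<close>, which turns real linear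
  functions into Laurent polynomials; these are closed under sums and products.\<close>

lemma laurent_polynomial_on_circle:
  fixes u :: "complex \<Rightarrow> real"
  assumes "real_polynomial_function u" and s: "0 < s"
  shows "\<exists>n p. \<forall>z\<in>sphere 0 s. of_real (u z) = poly p z / z ^ n"
  using assms(1)
proof induction
  case (linear u)
  then interpret bounded_linear u .
  define c where "c = Complex (u 1) (- u \<i>) / 2"
  show ?case
  proof (intro exI ballI)
    fix z :: complex assume z: "z \<in> sphere 0 s"
    then have z0: "z \<noteq> 0" using s by auto
    have "z * cnj z = of_real (s\<^sup>2)" using z by (simp add: complex_norm_square[symmetric])
    then have cz: "cnj z = of_real (s\<^sup>2) / z" using z0 by (simp add: field_simps)
    have "z = Re z *\<^sub>R 1 + Im z *\<^sub>R \<i>" by (simp add: complex_eq_iff)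
    then have "u z = u (Re z *\<^sub>R 1 + Im z *\<^sub>R \<i>)" by simp
    also have "\<dots> = Re z * u 1 + Im z * u \<i>" by (simp only: add scaleR real_scaleR_def)
    finally have "of_real (u z) = c * z + cnj c * cnj z"
      by (simp add: c_def complex_eq_iff field_simps)
    also have "\<dots> = poly [:cnj c * of_real (s\<^sup>2), 0, c:] z / z ^ 1"
      unfolding cz using z0 by (simp add: field_simps)
    finally show "of_real (u z) = poly [:cnj c * of_real (s\<^sup>2), 0, c:] z / z ^ 1" .
  qed
next
  case (const c)
  show ?case by (intro exI[of _ 0] exI[of _ "[:of_real c:]"]) simp
next
  case (add u v)
  then obtain n p m q where *: "\<And>z. z \<in> sphere 0 s \<Longrightarrow> of_real (u z) = poly p z / z ^ n"
    "\<And>z. z \<in> sphere 0 s \<Longrightarrow> of_real (v z) = poly q z / z ^ m" by blast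
  have "of_real (u z + v z) = poly (p * monom 1 m + q * monom 1 n) z / z ^ (n + m)"
    if "z \<in> sphere 0 s" for z
    using *[OF that] s that by (auto simp: poly_monom power_add field_simps)
  then show ?case by blast
next
  case (mult u v)
  then obtain n p m q where *: "\<And>z. z \<in> sphere 0 s \<Longrightarrow> of_real (u z) = poly p z / z ^ n"
    "\<And>z. z \<in> sphere 0 s \<Longrightarrow> of_real (v z) = poly q z / z ^ m" by blast
  have "of_real (u z * v z) = poly (p * q) z / z ^ (n + m)" if "z \<in> sphere 0 s" for z
    using *[OF that] by (simp add: power_add)
  then show ?case by blast
qed

text \<open>Taking real parts allows the conjugation of single terms, and on the circle the conjugate of
  \<open>c z\<^sup>-\<^sup>j\<close> is a multiple of \<open>z\<^sup>j\<close>. So the negative powers can be removed.\<close>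

lemma Re_laurent_polynomial_on_circle:
  fixes p :: "complex poly"
  assumes s: "0 < s"
  shows "\<exists>q. \<forall>z\<in>sphere 0 s. Re (poly p z / z ^ n) = Re (poly q z)"
proof -
  have mono: "\<exists>q. \<forall>z\<in>sphere 0 s. Re (c * z ^ k / z ^ n) = Re (poly q z)" for c k
  proof (cases "n \<le> k")
    case True
    have "Re (c * z ^ k / z ^ n) = Re (poly (monom c (k - n)) z)" if "z \<in> sphere 0 s" for z
    proof -
      have "z \<noteq> 0" using s that by auto
      then have "c * z ^ k / z ^ n = poly (monom c (k - n)) z"
        using True by (simp add: poly_monom power_diff)
      then show ?thesis by (simp only:)
    qed
    then show ?thesis by blast
  next
    case False
    define j where "j = n - k"
    have "Re (c * z ^ k / z ^ n) = Re (poly (monom (cnj c / of_real (s ^ (2 * j))) j) z)"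
      if z: "z \<in> sphere 0 s" for z
    proof -
      have z0: "z \<noteq> 0" using z s by auto
      have "z * cnj z = of_real (s\<^sup>2)" using z by (simp add: complex_norm_square[symmetric])
      then have inv: "1 / z = cnj z / of_real (s\<^sup>2)" using z0 s by (simp add: field_simps)
      have "n = k + j" using False by (simp add: j_def)
      then have "c * z ^ k / z ^ n = c * (1 / z) ^ j"
        using z0 by (simp add: power_add field_simps)
      also have "\<dots> = cnj (cnj c / of_real (s ^ (2 * j)) * z ^ j)"
        unfolding inv by (simp add: power_divide power_mult)
      finally show ?thesis by (simp only: poly_monom complex_cnj cnj.sel)
    qed
    then show ?thesis by blast
  qed
  have "\<exists>q. \<forall>k. \<forall>z\<in>sphere 0 s. Re (coeff p k * z ^ k / z ^ n) = Re (poly (q k) z)"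
    by (intro choice allI mono)
  then obtain q where q: "\<And>k z. z \<in> sphere 0 s \<Longrightarrow>
      Re (coeff p k * z ^ k / z ^ n) = Re (poly (q k) z)" by blast
  have "Re (poly p z / z ^ n) = Re (poly (\<Sum>k\<le>degree p. q k) z)" if z: "z \<in> sphere 0 s" for z
  proof -
    have "poly p z / z ^ n = (\<Sum>k\<le>degree p. coeff p k * z ^ k / z ^ n)"
      by (simp add: poly_altdef sum_divide_distrib)
    then have "Re (poly p z / z ^ n) = (\<Sum>k\<le>degree p. Re (coeff p k * z ^ k / z ^ n))"
      by (simp only: Re_sum)
    also have "\<dots> = Re (poly (\<Sum>k\<le>degree p. q k) z)"
      by (simp only: q[OF z] poly_sum Re_sum)
    finally show ?thesis .
  qed
  then show ?thesis by blast
qed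

text \<open>An approximate solution of the Dirichlet problem on the disc: continuous boundary values are matched
  up to an arbitrarily small error by the harmonic function \<open>Re q\<close>.\<close>

lemma continuous_approx_Re_poly_on_circle:
  fixes u :: "complex \<Rightarrow> real"
  assumes u: "continuous_on (sphere 0 s) u" and s: "0 < s" and e: "0 < e"
  obtains q where "\<And>z. z \<in> sphere 0 s \<Longrightarrow> \<bar>u z - Re (poly q z)\<bar> < e"
proof -
  obtain v where v: "real_polynomial_function v" "\<And>z. z \<in> sphere 0 s \<Longrightarrow> \<bar>u z - v z\<bar> < e"
    using Stone_Weierstrass_real_polynomial_function[OF compact_sphere u e] by blast
  obtain n p where np: "\<And>z. z \<in> sphere 0 s \<Longrightarrow> of_real (v z) = poly p z / z ^ n"
    using laurent_polynomial_on_circle[OF v(1) s] by blast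
  obtain q where q: "\<And>z. z \<in> sphere 0 s \<Longrightarrow> Re (poly p z / z ^ n) = Re (poly q z)"
    using Re_laurent_polynomial_on_circle[OF s] by blast
  have "v z = Re (poly q z)" if "z \<in> sphere 0 s" for z
    using q[OF that] np[OF that] by (metis Re_complex_of_real)
  then show thesis using v(2) by (intro that[of q]) auto
qed

section \<open>Monotonicity of means of subharmonic functions\<close>

text \<open>The function \<open>w\<close> is continuous and subharmonic. Let \<open>Re P\<close> exceed \<open>w\<close> slightly on the outer
  circle. The maximum modulus principle for \<open>g e\<^sup>-\<^sup>P\<close> and \<open>h e\<^sup>-\<^sup>P\<close> propagates \<open>w \<le> Re P\<close>
  to the disc. Since \<open>Re P\<close> has the same mean \<open>Re (P 0)\<close> on all circles, the mean of \<open>w\<close> over the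
  inner circle is at most the mean over the outer circle plus a small error.\<close>

lemma circle_mean_ln_max_mono:
  assumes g: "continuous_on (cball 0 s) g" "g holomorphic_on ball 0 s"
    and h: "continuous_on (cball 0 s) h" "h holomorphic_on ball 0 s"
    and nz: "\<And>z. z \<in> cball 0 s \<Longrightarrow> g z \<noteq> 0 \<or> h z \<noteq> 0"
    and rs: "0 < r" "r \<le> s"
  defines "w \<equiv> \<lambda>z. ln (max (cmod (g z)) (cmod (h z)))"
  shows "(\<lambda>\<theta>. w (of_real r * cis \<theta>)) integrable_on {0..2*pi}"
    and "integral {0..2*pi} (\<lambda>\<theta>. w (of_real r * cis \<theta>)) \<le> integral {0..2*pi} (\<lambda>\<theta>. w (of_real s * cis \<theta>))"
proof -
  have s: "0 < s" using rs by simp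
  have max_pos: "0 < max (cmod (g z)) (cmod (h z))" if "z \<in> cball 0 s" for z
    using nz[OF that] by (auto simp: less_max_iff_disj)
  have w: "continuous_on (cball 0 s) w"
    unfolding w_def by (intro continuous_intros g h) (use max_pos in force)
  have int: "(\<lambda>\<theta>. w (of_real t * cis \<theta>)) integrable_on {0..2*pi}" if "0 < t" "t \<le> s" for t
    by (intro integrable_continuous_real continuous_on_compose2[OF w] continuous_intros)
      (use that in \<open>auto simp: norm_mult\<close>)
  show "(\<lambda>\<theta>. w (of_real r * cis \<theta>)) integrable_on {0..2*pi}" by (rule int[OF rs])
  let ?I = "\<lambda>t. integral {0..2*pi} (\<lambda>\<theta>. w (of_real t * cis \<theta>))"
  show "?I r \<le> ?I s"
  proof (rule field_le_epsilon)
    fix e :: real assume e: "0 < e"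
    define d where "d = e / (4 * pi)"
    have d: "0 < d" using e by (simp add: d_def)
    obtain q where q: "\<And>z. z \<in> sphere 0 s \<Longrightarrow> \<bar>w z - Re (poly q z)\<bar> < d"
      using continuous_approx_Re_poly_on_circle[OF continuous_on_subset[OF w] s d]
        sphere_cball by blast
    \<comment> \<open>the shift by \<open>d\<close> turns the two-sided estimate into a majorant\<close>
    define P where "P z = poly q z + of_real d" for z
    have P_hol: "P holomorphic_on A" for A
      unfolding P_def by (intro holomorphic_intros)
    have on: "w z \<le> Re (P z)" "Re (P z) \<le> w z + 2 * d" if "z \<in> sphere 0 s" for z
      using q[OF that] by (auto simp: P_def)
    \<comment> \<open>used for both \<open>g\<close> and \<open>h\<close>, whose moduli are at most \<open>exp w\<close>\<close>
    have max_mod: "cmod (k z) \<le> exp (Re (P z))"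
      if k: "continuous_on (cball 0 s) k" "k holomorphic_on ball 0 s"
        and le: "\<And>z. z \<in> sphere 0 s \<Longrightarrow> cmod (k z) \<le> exp (w z)" and z: "z \<in> cball 0 s" for k z
    proof -
      have "cmod (k z * exp (- P z)) \<le> 1"
      proof (rule maximum_modulus_frontier[of "\<lambda>z. k z * exp (- P z)" "cball 0 s"])
        show "(\<lambda>z. k z * exp (- P z)) holomorphic_on interior (cball 0 s)"
          by (simp, intro holomorphic_intros k P_hol)
        show "continuous_on (closure (cball 0 s)) (\<lambda>z. k z * exp (- P z))"
          by (simp, intro continuous_intros k holomorphic_on_imp_continuous_on P_hol)
        fix z :: complex assume "z \<in> frontier (cball 0 s)"
        then have z: "z \<in> sphere 0 s" by auto
        have "cmod (k z) \<le> exp (Re (P z))"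
          using le[OF z] on(1)[OF z] by (meson exp_le_cancel_iff order_trans)
        then show "cmod (k z * exp (- P z)) \<le> 1"
          by (simp add: norm_mult norm_divide exp_minus field_simps)
      qed (use z in auto)
      then show ?thesis by (simp add: norm_mult norm_divide exp_minus field_simps)
    qed
    have exp_w: "exp (w z) = max (cmod (g z)) (cmod (h z))" if "z \<in> cball 0 s" for z
      using max_pos[OF that] by (simp add: w_def)
    have inside: "w z \<le> Re (P z)" if z: "z \<in> cball 0 s" for z
    proof -
      have "cmod (g z) \<le> exp (Re (P z))" "cmod (h z) \<le> exp (Re (P z))"
        by (intro max_mod g h z; subst exp_w; simp)+
      then have "exp (w z) \<le> exp (Re (P z))" unfolding exp_w[OF z] by simp
      then show ?thesis by simp
    qed
    have mean_P: "((\<lambda>\<theta>. Re (P (of_real t * cis \<theta>))) has_integral 2 * pi * Re (P 0)) {0..2*pi}"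
      if "0 < t" for t
      by (intro has_integral_circle_mean_Re holomorphic_on_imp_continuous_on P_hol that)
    have "?I r \<le> 2 * pi * Re (P 0)"
      by (rule has_integral_le[OF integrable_integral[OF int[OF rs]] mean_P[OF rs(1)]])
        (use rs in \<open>auto intro!: inside simp: norm_mult\<close>)
    also have "\<dots> \<le> ?I s + 4 * pi * d"
    proof (rule has_integral_le[OF mean_P[OF s]])
      have "((\<lambda>\<theta>. w (of_real s * cis \<theta>) + 2 * d) has_integral ?I s + (2 * pi - 0) * (2 * d)) {0..2*pi}"
        using has_integral_add[OF integrable_integral[OF int[OF s order_refl]]
          has_integral_const_real[of "2 * d" 0 "2*pi"]] by simp
      then show "((\<lambda>\<theta>. w (of_real s * cis \<theta>) + 2 * d) has_integral ?I s + 4 * pi * d) {0..2*pi}"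
        by (simp add: mult.assoc)
      show "Re (P (of_real s * cis \<theta>)) \<le> w (of_real s * cis \<theta>) + 2 * d" for \<theta>
        by (rule on) (use s in \<open>auto simp: norm_mult\<close>)
    qed
    also have "4 * pi * d = e" by (simp add: d_def)
    finally show "?I r \<le> ?I s + e" .
  qed
qed

section \<open>Meromorphic functions as quotients\<close>

text \<open>On a compact set a meromorphic function has finitely many poles, so a polynomial \<open>h\<close> cancels them
  with multiplicity. At a pole the cancellation is exact: \<open>f h\<close> has a nonzero limit there, hence
  \<open>g\<close> and \<open>h\<close> have no common zero. The function \<open>f\<close> may have arbitrary values at finitely many points
  of the set, so \<open>g = f h\<close> holds only up to a finite set.\<close>

lemma meromorphic_compact_quotient:
  fixes f :: "complex \<Rightarrow> complex"
  assumes f: "f meromorphic_on K" and K: "compact K"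
  defines "A \<equiv> {z \<in> K. is_pole f z}"
  defines "h \<equiv> \<lambda>z. \<Prod>a\<in>A. (z - a) ^ nat (- zorder f a)"
  defines "g \<equiv> remove_sings (\<lambda>z. f z * h z)"
  shows "finite A" "g analytic_on K" "\<And>z. z \<in> K \<Longrightarrow> g z \<noteq> 0 \<or> h z \<noteq> 0"
    "finite {z \<in> K. g z \<noteq> f z * h z}"
proof -
  have fin: "finite (K \<inter> {w. \<not> f analytic_on {w}})"
    by (rule sparse_in_compact_finite[OF meromorphic_on_imp_sparse_singularities[OF f] K])
  moreover have "A \<subseteq> K \<inter> {w. \<not> f analytic_on {w}}"
    using analytic_at_imp_no_pole by (auto simp: A_def)
  ultimately show A: "finite A" by (rule finite_subset[rotated])
  have h_an: "h analytic_on S" for S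
    unfolding h_def by (intro analytic_intros)
  have h0: "h z \<noteq> 0" if "z \<notin> A" for z
    using A that by (auto simp: h_def)
  have f_at: "isolated_singularity_at f z" "not_essential f z" if "z \<in> K" for z
    using f that by (auto simp: meromorphic_on_altdef)
  have "(\<lambda>z. f z * h z) meromorphic_on K"
    by (intro meromorphic_intros f analytic_on_imp_meromorphic_on h_an)
  then have iso: "isolated_singularity_at (\<lambda>z. f z * h z) z" if "z \<in> K" for z
    using that by (auto simp: meromorphic_on_altdef)
  have h_lim: "h \<midarrow>z\<rightarrow> h z" for z
    using h_an analytic_at_imp_isCont isContD by blast
  have lim: "\<exists>c. (\<lambda>z. f z * h z) \<midarrow>z\<rightarrow> c \<and> (c \<noteq> 0 \<or> h z \<noteq> 0)" if z: "z \<in> K" for z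
  proof (cases "z \<in> A")
    case False
    then have "\<not> is_pole f z" using z by (simp add: A_def)
    then obtain c where "f \<midarrow>z\<rightarrow> c" using f_at[OF z] by (auto simp: not_essential_def)
    then show ?thesis using tendsto_mult[OF _ h_lim] h0[OF False] by blast
  next
    case True
    then have pole: "is_pole f z" by (simp add: A_def)
    define k where "k w = (\<Prod>a\<in>A - {z}. (w - a) ^ nat (- zorder f a))" for w
    have h_eq: "h w = (w - z) ^ nat (- zorder f z) * k w" for w
      unfolding h_def k_def using A True by (rule prod.remove)
    have "isCont k z" unfolding k_def by (intro continuous_intros)
    then have k_lim: "k \<midarrow>z\<rightarrow> k z" by (rule isContD)
    have k0: "k z \<noteq> 0" using A by (auto simp: k_def)
    obtain r where r: "r > 0" "f holomorphic_on ball z r - {z}"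
      using f_at(1)[OF z] by (auto simp: isolated_singularity_at_def dest: analytic_imp_holomorphic)
    then obtain \<rho> where p0: "zor_poly f z z \<noteq> 0" and "\<rho> > 0"
      and p: "zor_poly f z holomorphic_on cball z \<rho>"
      using zorder_exist_pole[OF r(2) open_ball _ pole] by auto
    then have "isCont (zor_poly f z) z"
      by (metis analytic_at_ball analytic_at_imp_isCont ball_subset_cball holomorphic_on_subset)
    then have "zor_poly f z \<midarrow>z\<rightarrow> zor_poly f z z" by (rule isContD)
    moreover have "\<forall>\<^sub>F w in at z. zor_poly f z w = f w * (w - z) ^ nat (- zorder f z)"
      by (rule zor_poly_pole_eq[OF f_at(1)[OF z] pole])
    ultimately have "(\<lambda>w. f w * (w - z) ^ nat (- zorder f z)) \<midarrow>z\<rightarrow> zor_poly f z z"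
      by (rule Lim_transform_eventually)
    then have "(\<lambda>w. f w * h w) \<midarrow>z\<rightarrow> zor_poly f z z * k z"
      unfolding h_eq mult.assoc[symmetric] by (intro tendsto_mult k_lim)
    then show ?thesis using p0 k0 by (metis mult_eq_0_iff)
  qed
  have g_an: "g analytic_on {z}" if "z \<in> K" for z
    unfolding g_def using lim[OF that] iso[OF that] remove_sings_analytic_at by blast
  then show "g analytic_on K" using analytic_on_analytic_at by blast
  show "g z \<noteq> 0 \<or> h z \<noteq> 0" if "z \<in> K" for z
    using lim[OF that] remove_sings_eqI unfolding g_def by blast
  have "{z \<in> K. g z \<noteq> f z * h z} \<subseteq> K \<inter> {w. \<not> f analytic_on {w}}"
  proof safe
    fix z assume "f analytic_on {z}" "g z \<noteq> f z * h z"
    moreover have "(\<lambda>z. f z * h z) analytic_on {z}" if "f analytic_on {z}"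
      by (intro analytic_intros that h_an)
    ultimately show False unfolding g_def by (metis remove_sings_at_analytic)
  qed
  then show "finite {z \<in> K. g z \<noteq> f z * h z}" using fin by (rule finite_subset)
qed

section \<open>The characteristic is nondecreasing\<close>

lemma has_integral_threshold_inverse:
  fixes c r :: real
  assumes c: "0 < c" and r: "0 \<le> r"
  shows "((\<lambda>t. (if c \<le> t then 1 else 0) / t) has_integral ln (max r c) - ln c) {0..r}"
proof (cases "c \<le> r")
  case True
  have "((\<lambda>t. (if c \<le> t then 1 else 0) / t) has_integral 0) {0..c}"
    by (rule has_integral_spike_finite[of "{c}" _ _ "\<lambda>_. 0"]) auto
  moreover have "((\<lambda>t. 1 / t) has_integral ln r - ln c) {c..r}"
    by (rule fundamental_theorem_of_calculus[OF True])
      (use c in \<open>auto intro!: derivative_eq_intros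
        simp flip: has_real_derivative_iff_has_vector_derivative\<close>)
  then have "((\<lambda>t. (if c \<le> t then 1 else 0) / t) has_integral ln r - ln c) {c..r}"
    by (rule has_integral_eq[rotated]) auto
  ultimately have "((\<lambda>t. (if c \<le> t then 1 else 0) / t) has_integral 0 + (ln r - ln c)) {0..r}"
    by (rule has_integral_combine[rotated 2]) (use c True in auto)
  then show ?thesis using True by simp
next
  case False
  have "((\<lambda>t. (if c \<le> t then 1 else 0) / t) has_integral 0) {0..r}"
    by (rule has_integral_eq[OF _ has_integral_0]) (use False in auto)
  then show ?thesis using False by simp
qed

text \<open>Each pole \<open>a \<noteq> 0\<close>, counted with multiplicity, contributes \<open>ln (max r \<bar>a\<bar>) - ln \<bar>a\<bar>\<close>, and a pole at \<open>0\<close> contributes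
  \<open>ln r\<close>. The set \<open>A\<close> is the same for all \<open>r \<le> s\<close>, so the dependence on \<open>r\<close> sits in
  the first sum only.\<close>

lemma nev_counting_eq:
  assumes A: "finite {a. cmod a \<le> s \<and> is_pole f a}" and r: "0 < r" "r \<le> s"
  defines "A \<equiv> {a. cmod a \<le> s \<and> is_pole f a}" and "m \<equiv> \<lambda>a. real (nat (- zorder f a))"
  shows "nev_counting f r
    = (\<Sum>a\<in>A. m a * ln (max r (cmod a))) - (\<Sum>a\<in>A - {0}. m a * ln (cmod a))"
proof -
  have fin: "finite A" using A by (simp add: A_def)
  have count: "real (pole_count f t) = (\<Sum>a\<in>A. m a * (if cmod a \<le> t then 1 else 0))"
    if "t \<le> s" for t
  proof -
    have "{z. cmod z \<le> t \<and> is_pole f z} = {a\<in>A. cmod a \<le> t}" using that by (auto simp: A_def)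
    then have "real (pole_count f t) = (\<Sum>a\<in>{a\<in>A. cmod a \<le> t}. m a)"
      by (simp add: pole_count_def m_def)
    also have "\<dots> = (\<Sum>a\<in>A. if cmod a \<le> t then m a else 0)"
      using fin by (rule sum.inter_filter)
    also have "\<dots> = (\<Sum>a\<in>A. m a * (if cmod a \<le> t then 1 else 0))"
      by (intro sum.cong) auto
    finally show ?thesis .
  qed
  \<comment> \<open>the origin is separated because its term in the counting function is \<open>ln r\<close>\<close>
  define m0 where "m0 = (if 0 \<in> A then m 0 else 0)"
  have split0: "(\<Sum>a\<in>A. m a * \<phi> a) = m0 * \<phi> 0 + (\<Sum>a\<in>A - {0}. m a * \<phi> a)" for \<phi>
    using fin by (auto simp: m0_def sum.remove)
  have count0: "real (pole_count f 0) = m0"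
    using r by (subst count) (auto simp: split0 intro!: sum.neutral)
  have diff: "(real (pole_count f t) - real (pole_count f 0)) / t
      = (\<Sum>a\<in>A - {0}. m a * ((if cmod a \<le> t then 1 else 0) / t))" if "t \<in> {0..r}" for t
    unfolding count0 using that r by (subst count) (auto simp: split0 sum_divide_distrib)
  have "((\<lambda>t. \<Sum>a\<in>A - {0}. m a * ((if cmod a \<le> t then 1 else 0) / t)) has_integral
      (\<Sum>a\<in>A - {0}. m a * (ln (max r (cmod a)) - ln (cmod a)))) {0..r}"
    by (intro has_integral_sum has_integral_mult_right has_integral_threshold_inverse)
      (use fin r in auto)
  then have "((\<lambda>t. (real (pole_count f t) - real (pole_count f 0)) / t) has_integral
      (\<Sum>a\<in>A - {0}. m a * (ln (max r (cmod a)) - ln (cmod a)))) {0..r}"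
    by (rule has_integral_eq[rotated]) (simp only: diff)
  then have "nev_counting f r
      = (\<Sum>a\<in>A - {0}. m a * (ln (max r (cmod a)) - ln (cmod a))) + m0 * ln r"
    unfolding nev_counting_def count0[symmetric] by (simp add: integral_unique)
  then show ?thesis
    using r by (simp add: split0 right_diff_distrib sum_subtractf)
qed

text \<open>Write \<open>f = g / h\<close> on the disc of radius \<open>s\<close>. Then \<open>log\<^sup>+ \<bar>f\<bar> = ln (max \<bar>g\<bar> \<bar>h\<bar>) - ln \<bar>h\<bar>\<close>, and
  the mean of \<open>ln \<bar>h\<bar>\<close> over the circle of radius \<open>t\<close> is exactly the part of the counting function
  that depends on \<open>t\<close>. The two cancel, and the characteristic is the mean of
  \<open>ln (max \<bar>g\<bar> \<bar>h\<bar>)\<close> up to a constant \<open>C\<close>.\<close>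

lemma nev_char_mono:
  assumes f: "f meromorphic_on UNIV" and rs: "0 < r" "r \<le> s"
  shows "nev_char f r \<le> nev_char f s"
proof -
  define K where "K = cball (0::complex) s"
  define A where "A = {z \<in> K. is_pole f z}"
  define m where "m a = nat (- zorder f a)" for a
  define h where "h z = (\<Prod>a\<in>A. (z - a) ^ m a)" for z
  define g where "g = remove_sings (\<lambda>z. f z * h z)"
  define w where "w z = ln (max (cmod (g z)) (cmod (h z)))" for z
  note quotient = meromorphic_compact_quotient[of f K, folded A_def m_def, folded h_def, folded g_def]
  have K: "f meromorphic_on K" "compact K"
    using meromorphic_on_subset[OF f] by (auto simp: K_def)
  note fin = quotient(1)[OF K] and g_an = quotient(2)[OF K]
    and nz = quotient(3)[OF K] and exc = quotient(4)[OF K]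
  have h_hol: "h holomorphic_on S" for S unfolding h_def by (intro holomorphic_intros)
  have g_hol: "g holomorphic_on K" using g_an by (rule analytic_imp_holomorphic)
  have A_eq: "A = {a. cmod a \<le> s \<and> is_pole f a}" by (auto simp: A_def K_def)
  have int_w: "(\<lambda>\<theta>. w (of_real t * cis \<theta>)) integrable_on {0..2*pi}" 
    and mono_w: "integral {0..2*pi} (\<lambda>\<theta>. w (of_real t * cis \<theta>))
      \<le> integral {0..2*pi} (\<lambda>\<theta>. w (of_real s * cis \<theta>))" if "0 < t" "t \<le> s" for t
    unfolding w_def
    by (rule circle_mean_ln_max_mono;
        (use g_hol h_hol nz that in \<open>auto simp: K_def intro: holomorphic_on_imp_continuous_on
          holomorphic_on_subset[OF _ ball_subset_cball]\<close>))+
  let ?I = "\<lambda>t. integral {0..2*pi} (\<lambda>\<theta>. w (of_real t * cis \<theta>))"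
  define C where "C = (\<Sum>a\<in>A - {0}. real (m a) * ln (cmod a))"
  have T: "nev_char f t = ?I t / (2 * pi) - C" if t: "0 < t" "t \<le> s" for t
  proof -
    \<comment> \<open>off the finite set \<open>B\<close> the identity for \<open>log\<^sup>+ \<bar>f\<bar>\<close> holds pointwise; a circle meets
      \<open>B\<close> in finitely many points\<close>
    define B where "B = {z \<in> K. g z \<noteq> f z * h z} \<union> A"
    have on: "log_plus (cmod (f z)) = w z - (\<Sum>a\<in>A. real (m a) * ln (cmod (z - a)))"
      if "z \<in> K" "z \<notin> B" for z
    proof -
      have gz: "g z = f z * h z" and "z \<notin> A" using that by (auto simp: B_def)
      then have za: "cmod (z - a) > 0" if "a \<in> A" for a using that by auto
      have hz: "cmod (h z) = (\<Prod>a\<in>A. cmod (z - a) ^ m a)"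
        by (simp add: h_def norm_power flip: prod_norm)
      have h_pos: "0 < cmod (h z)" unfolding hz using za by (auto intro!: prod_pos)
      have "ln (cmod (h z)) = (\<Sum>a\<in>A. ln (cmod (z - a) ^ m a))"
        unfolding hz by (rule ln_prod) (use za in \<open>auto simp: fin\<close>)
      also have "\<dots> = (\<Sum>a\<in>A. real (m a) * ln (cmod (z - a)))"
        by (intro sum.cong refl ln_realpow za)
      finally have ln_h: "ln (cmod (h z)) = (\<Sum>a\<in>A. real (m a) * ln (cmod (z - a)))" .
      have "max (cmod (g z)) (cmod (h z)) = max (cmod (f z)) 1 * cmod (h z)"
        using h_pos by (auto simp: gz norm_mult max_def)
      then have "w z = ln (max (cmod (f z)) 1) + ln (cmod (h z))"
        using h_pos by (simp add: w_def ln_mult)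
      moreover have "log_plus (cmod (f z)) = ln (max (cmod (f z)) 1)"
        by (auto simp: log_plus_def max_def)
      ultimately show ?thesis by (simp add: ln_h)
    qed
    have "((\<lambda>\<theta>. w (of_real t * cis \<theta>) - (\<Sum>a\<in>A. real (m a) * ln (cmod (of_real t * cis \<theta> - a))))
        has_integral ?I t - (\<Sum>a\<in>A. real (m a) * (2 * pi * ln (max t (cmod a))))) {0..2*pi}"
      by (intro has_integral_diff has_integral_sum has_integral_mult_right
          has_integral_ln_dist_circle integrable_integral int_w t fin)
    then have "((\<lambda>\<theta>. log_plus (cmod (f (of_real t * cis \<theta>))))
        has_integral ?I t - (\<Sum>a\<in>A. real (m a) * (2 * pi * ln (max t (cmod a))))) {0..2*pi}"
    proof (rule has_integral_spike_finite[rotated 2])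
      show "finite {\<theta> \<in> {0..2*pi}. of_real t * cis \<theta> \<in> B}"
        by (rule finite_circle_vimage) (use exc fin t in \<open>auto simp: B_def\<close>)
      fix \<theta> assume "\<theta> \<in> {0..2*pi} - {\<theta> \<in> {0..2*pi}. of_real t * cis \<theta> \<in> B}"
      then show "log_plus (cmod (f (of_real t * cis \<theta>))) = w (of_real t * cis \<theta>)
          - (\<Sum>a\<in>A. real (m a) * ln (cmod (of_real t * cis \<theta> - a)))"
        by (intro on) (use t in \<open>auto simp: K_def norm_mult\<close>)
    qed
    then have "nev_proximity f t
        = (?I t - 2 * pi * (\<Sum>a\<in>A. real (m a) * ln (max t (cmod a)))) / (2 * pi)"
      by (simp add: nev_proximity_def integral_unique sum_distrib_left mult_ac)
    also have "\<dots> = ?I t / (2 * pi) - (\<Sum>a\<in>A. real (m a) * ln (max t (cmod a)))"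
      by (simp add: diff_divide_distrib)
    finally show ?thesis
      using nev_counting_eq[of s f t] fin t
      by (simp add: nev_char_def C_def m_def A_eq)
  qed
  have "0 < s" using rs by simp
  show ?thesis
    unfolding T[OF rs] T[OF \<open>0 < s\<close> order_refl]
    using mono_w[OF rs] by (simp add: divide_right_mono)
qed

section \<open>A growth lemma of Borel type\<close>

text \<open>Sort the bad points by the size of \<open>u r\<close> into the bands between consecutive tower values \<open>a\<^sub>k\<close>,
  starting with the band from \<open>0\<close> to \<open>a\<^sub>0 = 1\<close>. In the band below \<open>a\<^sub>k\<close> we have
  \<open>exp (u r) \<ge> a\<^sub>k\<close>. So from a bad point \<open>r\<close> of this band a step of length
  \<open>exp (- u r) \<le> 1 / a\<^sub>k\<close> takes \<open>u\<close> above \<open>a\<^sub>k\<close> and therefore, by monotonicity, out of the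
  band for good. Hence the bad points of the band lie in an interval of length \<open>1 / a\<^sub>k\<close>, and these
  lengths sum to \<open>S\<^sub>e\<close>. Covering by intervals also settles measurability.\<close>

lemma Borel_growth_exp:
  fixes u :: "real \<Rightarrow> real"
  assumes mono: "\<And>r s. 0 < r \<Longrightarrow> r \<le> s \<Longrightarrow> u r \<le> u s" and nonneg: "\<And>r. 0 < r \<Longrightarrow> 0 \<le> u r"
  shows "\<exists>E \<in> sets lebesgue. emeasure lebesgue E \<le> ennreal S_e \<and>
    (\<forall>r \<in> {0<..} - E. u (r + 1 / exp (u r)) \<le> exp (u r))"
proof -
  define bad where "bad r \<longleftrightarrow> exp (u r) < u (r + 1 / exp (u r))" for r
  \<comment> \<open>the lower end of band \<open>k\<close> is \<open>ln a\<^sub>k\<close>, that is \<open>0\<close> for \<open>k = 0\<close> and \<open>a\<^sub>k\<^sub>-\<^sub>1\<close> otherwise\<close>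
  define B where "B k = {r. 0 < r \<and> bad r \<and> exp_tower k \<le> exp (u r) \<and> u r < exp_tower k}" for k
  define E where "E k = (if B k = {} then {} else {Inf (B k)..Inf (B k) + inverse (exp_tower k)})" for k
  have tower_pos: "0 < exp_tower k" for k
    using exp_tower_ge[of k] by (meson less_le_trans zero_less_numeral zero_less_power)
  have short: "t \<le> r + inverse (exp_tower k)" if r: "r \<in> B k" and t: "t \<in> B k" for r t k
  proof -
    have "t < r + 1 / exp (u r)"
    proof (rule ccontr)
      assume "\<not> t < r + 1 / exp (u r)"
      then have "u (r + 1 / exp (u r)) \<le> u t"
        using r by (intro mono) (auto simp: B_def add_pos_pos)
      also have "\<dots> < exp_tower k" using t by (simp add: B_def)
      also have "\<dots> \<le> exp (u r)" using r by (simp add: B_def)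
      also have "\<dots> < u (r + 1 / exp (u r))" using r by (simp add: B_def bad_def)
      finally show False .
    qed
    also have "1 / exp (u r) \<le> inverse (exp_tower k)"
      using r tower_pos[of k] by (simp add: B_def inverse_eq_divide frac_le)
    finally show ?thesis by simp
  qed
  have B_sub: "B k \<subseteq> E k" for k
  proof
    fix t assume t: "t \<in> B k"
    have "bdd_below (B k)" by (rule bdd_belowI[of _ 0]) (auto simp: B_def)
    then have "Inf (B k) \<le> t" using t by (intro cInf_lower)
    moreover have "t - inverse (exp_tower k) \<le> Inf (B k)"
      using t short by (intro cInf_greatest) (auto simp: diff_le_eq)
    ultimately show "t \<in> E k" using t by (auto simp: E_def)
  qed
  have emeasure_E: "emeasure lebesgue (E k) \<le> ennreal (inverse (exp_tower k))" for k
    using tower_pos[of k] by (simp add: E_def)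
  have "emeasure lebesgue (\<Union>k. E k) \<le> (\<Sum>k. emeasure lebesgue (E k))"
    by (rule emeasure_subadditive_countably) (auto simp: E_def)
  also have "\<dots> \<le> (\<Sum>k. ennreal (inverse (exp_tower k)))"
    by (intro suminf_le emeasure_E) auto
  also have "\<dots> = ennreal S_e"
    unfolding S_e_def using tower_pos
    by (intro suminf_ennreal2 summable_inverse_exp_tower) (simp add: less_imp_le)
  finally have "emeasure lebesgue (\<Union>k. E k) \<le> ennreal S_e" .
  moreover have "(\<Union>k. E k) \<in> sets lebesgue" by (auto simp: E_def)
  moreover have "u (r + 1 / exp (u r)) \<le> exp (u r)" if r: "r \<in> {0<..} - (\<Union>k. E k)" for r
  proof (rule ccontr)
    assume "\<not> ?thesis"
    then have bad: "bad r" by (simp add: bad_def)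
    obtain n where "u r < 2 ^ n" using real_arch_pow[of 2 "u r"] by auto
    then have ex: "u r < exp_tower n" using exp_tower_ge[of n] by linarith
    define k where "k = (LEAST k. u r < exp_tower k)"
    have k: "u r < exp_tower k" unfolding k_def using ex by (rule LeastI)
    have "exp_tower k \<le> exp (u r)"
    proof (cases k)
      case 0
      then show ?thesis using nonneg[of r] r by simp
    next
      case (Suc j)
      then have "\<not> u r < exp_tower j" unfolding k_def by (metis lessI not_less_Least)
      then show ?thesis using Suc by simp
    qed
    then have "r \<in> B k" using bad k r by (simp add: B_def)
    then show False using B_sub r by blast
  qed
  ultimately show ?thesis by blast
qed

section \<open>The estimate outside the exceptional set\<close>

theorem theorem8:
  fixes f :: "complex \<Rightarrow> complex" and \<sigma> :: real
  assumes "0 < \<sigma>" and "\<sigma> < 1"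
    and "f meromorphic_on UNIV"
    and "nev_order f = \<infinity>"
    and "\<And>r. r > 0 \<Longrightarrow> nev_char f r > 0"
  shows "\<exists>E \<in> sets lebesgue. emeasure lebesgue E \<le> ennreal S_e \<and>
           (\<forall>r \<in> {0<..} - E.
              let R = r + 1 / exp (nev_char f r powr \<sigma>) in
                log_plus (nev_char f R / (R - r) * (R / r))
                  \<le> ((\<sigma> + 1) / \<sigma>) * nev_char f r powr \<sigma>
                     + ln (1 + 1 / (r * exp (nev_char f r powr \<sigma>))))"
proof -
  \<comment> \<open>The logarithm splits as \<open>ln T(R) + u r + ln (R / r)\<close>, so what remains is \<open>ln T(R) \<le> u r / \<sigma>\<close>,
    which is the logarithm of the growth bound \<open>u R \<le> exp (u r)\<close> for \<open>u = T\<^sup>\<sigma>\<close>.\<close>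
  let ?T = "nev_char f"
  define u where "u r = ?T r powr \<sigma>" for r
  have "u r \<le> u s" if "0 < r" "r \<le> s" for r s
    unfolding u_def using assms(1) assms(5)[of r] nev_char_mono[OF assms(3) that] that
    by (intro powr_mono2) auto
  then obtain E where E: "E \<in> sets lebesgue" "emeasure lebesgue E \<le> ennreal S_e"
    and good: "\<And>r. r \<in> {0<..} - E \<Longrightarrow> u (r + 1 / exp (u r)) \<le> exp (u r)"
    using Borel_growth_exp[of u] by (force simp: u_def)
  have "log_plus (?T R / (R - r) * (R / r)) \<le> ((\<sigma> + 1) / \<sigma>) * u r + ln (1 + 1 / (r * exp (u r)))"
    if r: "r \<in> {0<..} - E" and R: "R = r + 1 / exp (u r)" for r R
  proof -
    have r0: "0 < r" using r by simp
    then have R0: "0 < R" unfolding R by (simp add: add_pos_pos)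
    have T: "0 < ?T R" using assms(5) R0 by simp
    have quot: "R / r = 1 + 1 / (r * exp (u r))" unfolding R using r0 by (simp add: field_simps)
    have one: "1 < R / r" unfolding quot using r0 by simp
    have "?T R / (R - r) = ?T R * exp (u r)" by (simp add: R)
    then have "ln (?T R / (R - r) * (R / r)) = ln (?T R) + u r + ln (R / r)"
      using T r0 R0 by (simp add: ln_mult ln_div)
    moreover have "ln (?T R) \<le> u r / \<sigma>"
    proof -
      have "?T R powr \<sigma> \<le> exp (u r)" using good[OF r] by (simp add: u_def R)
      then have "ln (?T R powr \<sigma>) \<le> ln (exp (u r))" using T by (intro ln_mono) auto
      then have "\<sigma> * ln (?T R) \<le> u r" using T by (simp add: ln_powr)
      then show ?thesis using assms(1) by (simp add: field_simps)
    qed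
    moreover have "u r / \<sigma> + u r = (\<sigma> + 1) / \<sigma> * u r" using assms(1) by (simp add: field_simps)
    moreover have "0 \<le> (\<sigma> + 1) / \<sigma> * u r" using assms(1) by (simp add: u_def)
    moreover have "0 \<le> ln (R / r)" using one by simp
    ultimately show ?thesis unfolding log_plus_def quot[symmetric] by auto
  qed
  then show ?thesis using E unfolding u_def Let_def by blast
qed

end
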